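(* There exists a positive absolute constant $c$ with $c \geq 0.0003$ such that the following holds. Fix any balance parameter $p \in (0,1)$, any number $r$ of vertices (a positive integer), and any dimension $n$ (a positive integer). Draw a random set $F$ from the distribution $\mathrm{Face}(p, r, n)$. Then $$ \mathbb{P}\left\{ F \text{ is a simplicial face of } \mathcal{E}_n \text{ with dimension } r-1 \right\} \;\geq\; 1 - 4 \exp\left( \frac{r^2 - c\, p^2(1-p)^2 n}{4} \right). $$
   Context: The elliptope $\mathcal{E}_n$ is the convex set of all $n \times n$ real symmetric positive-semidefinite matrices whose diagonal entries are all equal to one. The signed Bernoulli distribution $\mathrm{SBern}(p)$ with parameter $p \in [0,1]$ takes the value $+1$ with probability $p$ and the value $-1$ with probability $1-p$. A random vector with distribution $\mathrm{SBern}(p,n)$ takes values in $\{\pm 1\}^n$ and has $n$ independent entries, each with distribution $\mathrm{SBern}(p)$. The random model $\mathrm{Face}(p,r,n)$: draw (column) random vectors $\boldsymbol{\xi}_1, \dots, \boldsymbol{\xi}_r$ independently from $\mathrm{SBern}(p,n)$ and set $$F := \operatorname{conv}\{ \boldsymbol{\xi}_1 \boldsymbol{\xi}_1^{\mathsf{t}}, \dots, \boldsymbol{\xi}_r \boldsymbol{\xi}_r^{\mathsf{t}} \} \subset \mathcal{E}_n,$$ where ${}^{\mathsf{t}}$ is the transpose and $\operatorname{conv}$ the convex hull. The dimension of a convex set is the dimension of its affine hull. A face $F$ of a convex set $K$ is a convex subset of $K$ such that whenever $x, y \in K$ and $\theta x + (1-\theta) y \in F$ for some $\theta \in (0,1)$,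 it follows that $x, y \in F$. A $k$-dimensional face of a convex set is simplicial if it is the convex hull of an affinely independent family of $k+1$ points. "Absolute constant" means that $c$ does not depend on $p$, $r$, or $n$. *)

theory Defs
  imports
    "HOL-Analysis.Analysis"
    "HOL-Probability.Probability"
    "HOL-Library.Function_Algebras"
begin

instantiation "fun" :: (type, real_vector) real_vector
begin

definition scaleR_fun :: "real \<Rightarrow> ('a \<Rightarrow> 'b) \<Rightarrow> 'a \<Rightarrow> 'b"
  where "scaleR_fun a f = (\<lambda>x. a *\<^sub>R f x)"

instance
  by standard (simp_all add: scaleR_fun_def plus_fun_def fun_eq_iff
      scaleR_add_right scaleR_add_left)

end

text \<open>Vectors in \<open>\<real>\<^sup>n\<close> and real \<open>n \<times> n\<close> matrices, with \<open>n\<close> an ordinary natural number, are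
  functions indexed by \<open>{..<n}\<close> that vanish outside the index range. They form subspaces
  (of dimension \<open>n\<close> and \<open>n\<^sup>2\<close>) of the real vector spaces \<^typ>\<open>nat \<Rightarrow> real\<close> and
  \<^typ>\<open>nat \<Rightarrow> nat \<Rightarrow> real\<close>, so the library notions \<^const>\<open>convex\<close>, \<open>convex hull\<close>, \<open>affine hull\<close>,
  \<^const>\<open>affine_dependent\<close> and \<^const>\<open>face_of\<close> apply to sets of matrices.\<close>

type_synonym rvec = "nat \<Rightarrow> real"
type_synonym rmat = "nat \<Rightarrow> nat \<Rightarrow> real"

definition square_matrix :: "nat \<Rightarrow> rmat \<Rightarrow> bool"
  where "square_matrix n X \<longleftrightarrow> (\<forall>i j. \<not> (i < n \<and> j < n) \<longrightarrow> X i j = 0)"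

definition symmetric_matrix :: "nat \<Rightarrow> rmat \<Rightarrow> bool"
  where "symmetric_matrix n X \<longleftrightarrow> (\<forall>i<n. \<forall>j<n. X i j = X j i)"

definition psd_matrix :: "nat \<Rightarrow> rmat \<Rightarrow> bool"
  where "psd_matrix n X \<longleftrightarrow>
    symmetric_matrix n X \<and> (\<forall>v :: rvec. 0 \<le> (\<Sum>i<n. \<Sum>j<n. v i * X i j * v j))"

definition elliptope :: "nat \<Rightarrow> rmat set"
  where "elliptope n = {X. square_matrix n X \<and> psd_matrix n X \<and> (\<forall>i<n. X i i = 1)}"

definition outer :: "rvec \<Rightarrow> rmat"
  where "outer x = (\<lambda>i j. x i * x j)"

text \<open>The dimension of the affine hull, as the dimension of its space of directions. The library's
  \<^const>\<open>aff_dim\<close> is restricted to Euclidean spaces. The value is meaningful for nonempty sets with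
  a finite-dimensional affine hull.\<close>

definition affine_dim :: "'a::real_vector set \<Rightarrow> nat"
  where "affine_dim S = dim {x - y | x y. x \<in> affine hull S \<and> y \<in> affine hull S}"

definition simplicial_face_of :: "'a::real_vector set \<Rightarrow> 'a set \<Rightarrow> bool"
  where "simplicial_face_of F K \<longleftrightarrow> F face_of K \<and>
    (\<exists>V. finite V \<and> card V = affine_dim F + 1 \<and> \<not> affine_dependent V \<and> F = convex hull V)"

definition SBern :: "real \<Rightarrow> real pmf"
  where "SBern p = map_pmf (\<lambda>b. if b then 1 else - 1) (bernoulli_pmf p)"

text \<open>\<^const>\<open>Pi_pmf\<close> is the law of a family of independent entries, extended by the given default
  value outside the index set. Default \<open>0\<close> makes the samples vectors in the above sense.\<close>

definition SBern_vec :: "real \<Rightarrow> nat \<Rightarrow> rvec pmf"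
  where "SBern_vec p n = Pi_pmf {..<n} 0 (\<lambda>_. SBern p)"

definition Face :: "real \<Rightarrow> nat \<Rightarrow> nat \<Rightarrow> rmat set pmf"
  where "Face p r n =
    map_pmf (\<lambda>\<xi> :: nat \<Rightarrow> rvec. convex hull ((\<lambda>k. outer (\<xi> k)) ` {..<r}))
      (Pi_pmf {..<r} 0 (\<lambda>_. SBern_vec p n))"

end

theory Submission
  imports Defs
begin

text \<open>Write \<open>\<xi> k\<close>, for \<open>k < r\<close>, for the random sign vectors. The proof splits into a deterministic criterion
for the hull of the matrices \<open>outer (\<xi> k)\<close> to be a simplicial face, and an estimate for the
probability that the criterion fails.

The criterion is Schur independence: the all-ones vector together with the entrywise products of
\<open>\<xi> k\<close> and \<open>\<xi> l\<close>, for \<open>k < l\<close>, is linearly independent. A positive-semidefinite matrix that occurs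
with positive weight when a point of the hull is decomposed into such matrices has its range in the
span of the \<open>\<xi> k\<close>, so it is a combination of the products \<open>\<xi> k (\<xi> l)\<^sup>t\<close>. If it has unit diagonal as well, Schur independence leaves
only the diagonal products, with nonnegative weights of sum one
(\<open>convex_hull_outer_face_of_elliptope\<close>). The vectors dual to the \<open>\<xi> k\<close> show that the vertices are
independent, so the face is a simplex of dimension \<open>r - 1\<close>.

For the estimate, read the sign matrix by rows. These are \<open>n\<close> independent points of the cube
\<open>{1, -1}\<^sup>r\<close>, and Schur independence says that no nonzero multilinear quadratic function without linear
terms vanishes at all of them. A fixed nonzero function of this kind is nonzero at a random point with
probability at least \<open>q = p\<^sup>2 (1 - p)\<^sup>2\<close>, because two discrete differences reduce it to a nonzero constant
(\<open>prob_quad_nonzero_ge\<close>). So each new row lowers the dimension of the space of functions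
vanishing at all rows, with probability at least \<open>q\<close> as long as this space is nonzero. It starts
with dimension at most \<open>r\<^sup>2 + 1\<close>, and it can only be nonzero at the end if at most \<open>r\<^sup>2\<close> of the \<open>n\<close> rows
were successful. An exponential moment bounds the probability of that by
\<open>exp (r\<^sup>2 / 4) (1 - q (1 - exp (- 1 / 4)))\<^sup>n\<close> (\<open>prob_common_zero_le\<close>).\<close>

section \<open>Simplicial faces\<close>

lemma affine_dim_convex_hull_independent:
  fixes V :: "'a::real_vector set"
  assumes "V \<noteq> {}" and "\<not> affine_dependent V"
  shows "affine_dim (convex hull V) = card V - 1"
proof -
  obtain a where a: "a \<in> V" using assms by auto
  define D where "D = (\<lambda>x. -a + x) ` (V - {a})"
  have ind: "independent D"
    using affine_dependent_iff_dependent2[OF a] assms unfolding D_def by simp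
  have hull: "affine hull (convex hull V) = (\<lambda>x. a + x) ` span D"
    unfolding D_def using affine_hull_span2[OF a] by simp
  have "{x - y | x y. x \<in> affine hull (convex hull V) \<and> y \<in> affine hull (convex hull V)} = span D"
    (is "?L = _")
  proof (intro set_eqI iffI)
    fix z assume "z \<in> ?L"
    then show "z \<in> span D" unfolding hull by (auto simp: span_diff)
  next
    fix z assume "z \<in> span D"
    then have "a + z \<in> (\<lambda>x. a + x) ` span D" "a + 0 \<in> (\<lambda>x. a + x) ` span D"
      using span_zero by blast+
    moreover have "z = (a + z) - (a + 0)" by simp
    ultimately show "z \<in> ?L" unfolding hull by blast
  qed
  then have "affine_dim (convex hull V) = card D"
    unfolding affine_dim_def using ind by (simp add: dim_eq_card_independent)
  also have "card D = card V - 1"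
    unfolding D_def using a by (subst card_image) (auto simp: inj_on_def card_Diff_singleton)
  finally show ?thesis .
qed

lemma simplicial_face_of_convex_hull:
  fixes V :: "'a::real_vector set"
  assumes "finite V" "V \<noteq> {}" "\<not> affine_dependent V" "convex hull V face_of K"
  shows "simplicial_face_of (convex hull V) K"
proof -
  have "card V > 0" using assms(1,2) by (simp add: card_gt_0_iff)
  then have "card V = affine_dim (convex hull V) + 1"
    using affine_dim_convex_hull_independent[OF assms(2,3)] by simp
  then show ?thesis unfolding simplicial_face_of_def using assms by blast
qed

section \<open>Orthogonality and dual families\<close>

definition vec_inner :: "nat \<Rightarrow> rvec \<Rightarrow> rvec \<Rightarrow> real"
  where "vec_inner n u v = (\<Sum>i<n. u i * v i)"

lemma vec_inner_commute: "vec_inner n u v = vec_inner n v u"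
  unfolding vec_inner_def by (simp add: mult.commute)

lemma vec_inner_linear_left:
  "vec_inner n (\<lambda>i. u i + w i) v = vec_inner n u v + vec_inner n w v"
  "vec_inner n (\<lambda>i. u i - w i) v = vec_inner n u v - vec_inner n w v"
  "vec_inner n (\<lambda>i. c * u i) v = c * vec_inner n u v"
  "vec_inner n (\<lambda>i. \<Sum>k\<in>I. f k i) v = (\<Sum>k\<in>I. vec_inner n (f k) v)"
proof -
  show "vec_inner n (\<lambda>i. \<Sum>k\<in>I. f k i) v = (\<Sum>k\<in>I. vec_inner n (f k) v)"
    unfolding vec_inner_def sum_distrib_right by (rule sum.swap)
qed (simp_all add: vec_inner_def sum.distrib sum_subtractf sum_distrib_left algebra_simps)

lemma vec_inner_self_eq_0: "vec_inner n u u = 0 \<longleftrightarrow> (\<forall>i<n. u i = 0)"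
  unfolding vec_inner_def by (subst sum_nonneg_eq_0_iff) auto

lemma vec_inner_left_eq_0: "vec_inner n u u = 0 \<Longrightarrow> vec_inner n u v = 0"
  unfolding vec_inner_self_eq_0 by (simp add: vec_inner_def)

text \<open>Projection onto the span of a finite family by Gram--Schmidt: to admit a further vector \<open>\<xi> m\<close>,
subtract the multiple of its residual \<open>z\<close> that makes the difference orthogonal to \<open>z\<close>. Coefficients are
indexed by the family, so repetitions among the vectors do no harm.\<close>

lemma exists_orthogonal_residual:
  assumes "finite I"
  shows "\<exists>a. \<forall>l\<in>I. vec_inner n (\<lambda>i. x i - (\<Sum>k\<in>I. a k * \<xi> k i)) (\<xi> l) = 0"
  using assms
proof (induction I arbitrary: x rule: finite_induct)
  case (insert m I)
  from insert.IH[of x] obtain a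
    where a: "\<And>l. l \<in> I \<Longrightarrow> vec_inner n (\<lambda>i. x i - (\<Sum>k\<in>I. a k * \<xi> k i)) (\<xi> l) = 0" by blast
  from insert.IH[of "\<xi> m"] obtain b
    where b: "\<And>l. l \<in> I \<Longrightarrow> vec_inner n (\<lambda>i. \<xi> m i - (\<Sum>k\<in>I. b k * \<xi> k i)) (\<xi> l) = 0" by blast
  define y where "y = (\<lambda>i. x i - (\<Sum>k\<in>I. a k * \<xi> k i))"
  define z where "z = (\<lambda>i. \<xi> m i - (\<Sum>k\<in>I. b k * \<xi> k i))"
  (* If z is a null vector, then t = 0 by the convention for division by zero, which is the right
     choice because y is then orthogonal to z already. *)
  define t where "t = vec_inner n y z / vec_inner n z z"
  define w where "w = (\<lambda>i. y i - t * z i)"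
  define c where "c k = (if k = m then t else a k - t * b k)" for k
  have w_eq: "w = (\<lambda>i. x i - (\<Sum>k\<in>insert m I. c k * \<xi> k i))"
  proof
    fix i
    have "(\<Sum>k\<in>I. c k * \<xi> k i) = (\<Sum>k\<in>I. a k * \<xi> k i) - t * (\<Sum>k\<in>I. b k * \<xi> k i)"
      unfolding sum_distrib_left sum_subtractf[symmetric]
      using insert.hyps(2) by (intro sum.cong) (auto simp: c_def algebra_simps)
    then show "w i = x i - (\<Sum>k\<in>insert m I. c k * \<xi> k i)"
      using insert.hyps unfolding w_def y_def z_def by (simp add: c_def algebra_simps)
  qed
  have w_old: "vec_inner n w (\<xi> l) = 0" if "l \<in> I" for l
    unfolding w_def vec_inner_linear_left using a[OF that] b[OF that] by (simp add: y_def z_def)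
  have "vec_inner n w z = vec_inner n y z - t * vec_inner n z z"
    unfolding w_def vec_inner_linear_left ..
  also have "\<dots> = 0"
    using vec_inner_left_eq_0[of n z y] by (auto simp: t_def vec_inner_commute[of n y z])
  finally have "vec_inner n w z = 0" .
  moreover have "vec_inner n w z = vec_inner n w (\<xi> m) - (\<Sum>k\<in>I. b k * vec_inner n w (\<xi> k))"
    unfolding z_def vec_inner_commute[of n w] vec_inner_linear_left ..
  ultimately have "vec_inner n w (\<xi> m) = 0" using w_old by simp
  then show ?case using w_old unfolding w_eq by blast
qed simp

text \<open>The vector dual to \<open>\<xi> k\<close> is the residual of \<open>\<xi> k\<close> modulo the other members, suitably rescaled.
Independence is what makes this residual nonzero.\<close>

lemma exists_dual_family:
  assumes "finite I"
    and indep: "\<And>a k. \<forall>i<n. (\<Sum>k\<in>I. a k * \<xi> k i) = 0 \<Longrightarrow> k \<in> I \<Longrightarrow> a k = (0::real)"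
  shows "\<exists>v. \<forall>k\<in>I. \<forall>l\<in>I. vec_inner n (v k) (\<xi> l) = (if k = l then 1 else 0)"
proof -
  have "\<exists>u. \<forall>l\<in>I. vec_inner n u (\<xi> l) = (if k = l then 1 else 0)" if k: "k \<in> I" for k
  proof -
    obtain a where a: "\<And>l. l \<in> I - {k} \<Longrightarrow> vec_inner n (\<lambda>i. \<xi> k i - (\<Sum>j\<in>I-{k}. a j * \<xi> j i)) (\<xi> l) = 0"
      using exists_orthogonal_residual[of "I - {k}" n "\<xi> k" \<xi>] assms(1) by blast
    define z where "z = (\<lambda>i. \<xi> k i - (\<Sum>j\<in>I-{k}. a j * \<xi> j i))"
    have zl: "vec_inner n z (\<xi> l) = 0" if "l \<in> I - {k}" for l
      using a[OF that] unfolding z_def .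
    have "vec_inner n z z = vec_inner n (\<xi> k) z - (\<Sum>j\<in>I-{k}. a j * vec_inner n (\<xi> j) z)"
      by (subst (1) z_def) (simp only: vec_inner_linear_left)
    also have "(\<Sum>j\<in>I-{k}. a j * vec_inner n (\<xi> j) z) = 0"
      using zl by (intro sum.neutral) (simp add: vec_inner_commute[of n _ z])
    finally have zk: "vec_inner n z (\<xi> k) = vec_inner n z z" by (simp add: vec_inner_commute)
    have "vec_inner n z z \<noteq> 0"
    proof
      assume "vec_inner n z z = 0"
      then have z0: "\<forall>i<n. z i = 0" unfolding vec_inner_self_eq_0 .
      define c where "c j = (if j = k then 1 else - a j)" for j
      have "(\<Sum>j\<in>I. c j * \<xi> j i) = z i" for i
        unfolding sum.remove[OF assms(1) k] z_def by (simp add: c_def sum_negf)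
      then have "c k = 0" using indep[of c k] z0 k by simp
      then show False by (simp add: c_def)
    qed
    then have "\<forall>l\<in>I. vec_inner n (\<lambda>i. 1 / vec_inner n z z * z i) (\<xi> l) = (if k = l then 1 else 0)"
      unfolding vec_inner_linear_left using zl zk by auto
    then show ?thesis by blast
  qed
  then show ?thesis by metis
qed

section \<open>Quadratic forms and the elliptope\<close>

definition qform :: "nat \<Rightarrow> rmat \<Rightarrow> rvec \<Rightarrow> rvec \<Rightarrow> real"
  where "qform n X u v = (\<Sum>i<n. \<Sum>j<n. u i * X i j * v j)"

lemma qform_eq_vec_inner: "qform n X u v = vec_inner n u (\<lambda>i. \<Sum>j<n. X i j * v j)"
  unfolding qform_def vec_inner_def by (simp add: sum_distrib_left mult_ac)

lemma qform_linear_left: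
  "qform n X (\<lambda>i. u i + w i) v = qform n X u v + qform n X w v"
  "qform n X (\<lambda>i. u i - w i) v = qform n X u v - qform n X w v"
  "qform n X (\<lambda>i. c * u i) v = c * qform n X u v"
  "qform n X (\<lambda>i. \<Sum>k\<in>I. f k i) v = (\<Sum>k\<in>I. qform n X (f k) v)"
  unfolding qform_eq_vec_inner by (rule vec_inner_linear_left)+

lemma qform_commute:
  assumes "symmetric_matrix n X"
  shows "qform n X u v = qform n X v u"
  unfolding qform_def using assms
  by (subst sum.swap) (auto simp: symmetric_matrix_def mult_ac intro!: sum.cong)

lemma qform_matrix:
  "qform n (\<lambda>i j. X i j + Y i j) u v = qform n X u v + qform n Y u v"
  "qform n (\<lambda>i j. c * X i j) u v = c * qform n X u v"
  unfolding qform_def by (simp_all add: sum.distrib sum_distrib_left algebra_simps)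

lemma qform_outer: "qform n (outer x) u v = vec_inner n u x * vec_inner n x v"
  unfolding qform_def vec_inner_def outer_def by (simp add: sum_product mult_ac)

lemma qform_unit:
  assumes "i < n" "j < n"
  shows "qform n X (\<lambda>a. if a = i then 1 else 0) (\<lambda>b. if b = j then 1 else 0) = X i j"
proof -
  have "qform n X (\<lambda>a. if a = i then 1 else 0) (\<lambda>b. if b = j then 1 else 0)
      = (\<Sum>a<n. \<Sum>b<n. if a = i then (if b = j then X a b else 0) else 0)"
    unfolding qform_def by (intro sum.cong) auto
  also have "\<dots> = (\<Sum>a<n. if a = i then X a j else 0)"
    using assms by (intro sum.cong) auto
  also have "\<dots> = X i j" using assms by simp
  finally show ?thesis .
qed

lemma psd_matrix_iff:
  "psd_matrix n X \<longleftrightarrow> symmetric_matrix n X \<and> (\<forall>v. 0 \<le> qform n X v v)"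
  unfolding psd_matrix_def qform_def ..

text \<open>A nonnegative quadratic that vanishes at a point has zero derivative there: otherwise moving from
\<open>v\<close> a little in the direction \<open>u\<close> or \<open>- u\<close> would make the form negative.\<close>

lemma psd_matrix_kernel:
  assumes X: "psd_matrix n X" and v: "qform n X v v = 0"
  shows "qform n X u v = 0"
proof -
  define a b where "a = qform n X u u" and "b = qform n X u v"
  have sym: "symmetric_matrix n X" and pos: "\<And>v. 0 \<le> qform n X v v"
    using X unfolding psd_matrix_iff by auto
  have a: "0 \<le> a" unfolding a_def by (rule pos)
  (* The minimizer would be - b / a; the summand 1 avoids a case distinction on a = 0. *)
  define t where "t = - b / (a + 1)"
  have "0 \<le> qform n X (\<lambda>i. v i + t * u i) (\<lambda>i. v i + t * u i)" by (rule pos)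
  also have "\<dots> = 2 * t * b + t\<^sup>2 * a"
    unfolding qform_linear_left qform_commute[OF sym, of _ "\<lambda>i. v i + t * u i"] v
    using qform_commute[OF sym, of v u]
    by (simp add: a_def b_def power2_eq_square algebra_simps)
  finally have "0 \<le> (2 * t * b + t\<^sup>2 * a) * (a + 1)\<^sup>2" by simp
  also have "\<dots> = 2 * (t * (a + 1)) * b * (a + 1) + (t * (a + 1))\<^sup>2 * a"
    by (simp add: power2_eq_square algebra_simps)
  also have "t * (a + 1) = - b" using a by (simp add: t_def)
  also have "2 * (- b) * b * (a + 1) + (- b)\<^sup>2 * a = - (b\<^sup>2 * (a + 2))"
    by (simp add: power2_eq_square algebra_simps)
  finally have "b\<^sup>2 * (a + 2) \<le> 0" by simp
  then have "b\<^sup>2 \<le> 0" using a by (simp add: mult_le_0_iff)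
  then show ?thesis by (simp add: b_def)
qed

lemma convex_elliptope: "convex (elliptope n)"
  unfolding convex_def
proof (intro ballI allI impI)
  fix X Y :: rmat and s t :: real
  assume X: "X \<in> elliptope n" and Y: "Y \<in> elliptope n" and st: "0 \<le> s" "0 \<le> t" "s + t = 1"
  have eq: "s *\<^sub>R X + t *\<^sub>R Y = (\<lambda>i j. s * X i j + t * Y i j)"
    by (simp add: fun_eq_iff scaleR_fun_def)
  show "s *\<^sub>R X + t *\<^sub>R Y \<in> elliptope n"
    unfolding eq using X Y st
    by (simp add: elliptope_def psd_matrix_iff qform_matrix square_matrix_def symmetric_matrix_def)
qed

section \<open>Faces spanned by Schur independent sign vectors\<close>

definition sign_family :: "nat \<Rightarrow> nat \<Rightarrow> (nat \<Rightarrow> rvec) \<Rightarrow> bool"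
  where "sign_family n r \<xi> \<longleftrightarrow>
    (\<forall>k<r. (\<forall>i<n. \<xi> k i \<in> {1, -1}) \<and> (\<forall>i\<ge>n. \<xi> k i = 0))"

lemma outer_in_elliptope:
  assumes "sign_family n r \<xi>" "k < r"
  shows "outer (\<xi> k) \<in> elliptope n"
proof -
  have "\<xi> k i * \<xi> k i = 1" if "i < n" for i
    using assms that unfolding sign_family_def by fastforce
  moreover have "0 \<le> qform n (outer (\<xi> k)) v v" for v
    by (simp add: qform_outer vec_inner_commute[of n v])
  ultimately show ?thesis
    using assms unfolding elliptope_def psd_matrix_iff
    by (auto simp: outer_def square_matrix_def symmetric_matrix_def sign_family_def)
qed

text \<open>The all-ones vector and the entrywise products of pairs of distinct members of the family are
  linearly independent.\<close>

definition schur_independent :: "nat \<Rightarrow> nat \<Rightarrow> (nat \<Rightarrow> rvec) \<Rightarrow> bool"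
  where "schur_independent n r \<xi> \<longleftrightarrow>
    (\<forall>\<alpha> c. (\<forall>i<n. \<alpha> + (\<Sum>l<r. \<Sum>k<l. c k l * (\<xi> k i * \<xi> l i)) = 0) \<longrightarrow>
      \<alpha> = 0 \<and> (\<forall>l<r. \<forall>k<l. c k l = 0))"

lemma sum_square_split:
  fixes M :: "nat \<Rightarrow> nat \<Rightarrow> real"
  shows "(\<Sum>k<r. \<Sum>l<r. M k l) = (\<Sum>k<r. M k k) + (\<Sum>l<r. \<Sum>k<l. M k l + M l k)"
  by (induction r) (simp_all add: sum.distrib)

text \<open>Since the squares of the signs are one, a quadratic expression in them is a constant, the trace of \<open>M\<close>,
plus a combination of products of distinct members. Schur independence allows the coefficients to be
compared.\<close>

lemma schur_independent_quadratic:
  fixes M :: "nat \<Rightarrow> nat \<Rightarrow> real"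
  assumes sgn: "sign_family n r \<xi>" and schur: "schur_independent n r \<xi>"
    and M: "\<And>i. i < n \<Longrightarrow> (\<Sum>k<r. \<Sum>l<r. M k l * (\<xi> k i * \<xi> l i)) = \<beta>"
  shows "(\<Sum>k<r. M k k) = \<beta>"
    and "k < r \<Longrightarrow> l < r \<Longrightarrow> k \<noteq> l \<Longrightarrow> M k l + M l k = 0"
proof -
  define \<alpha> where "\<alpha> = (\<Sum>k<r. M k k) - \<beta>"
  have *: "\<alpha> + (\<Sum>l<r. \<Sum>k<l. (M k l + M l k) * (\<xi> k i * \<xi> l i)) = 0" if i: "i < n" for i
  proof -
    have "\<xi> k i * \<xi> k i = 1" if "k < r" for k
      using sgn i that unfolding sign_family_def by fastforce
    then have "(\<Sum>k<r. M k k * (\<xi> k i * \<xi> k i)) = (\<Sum>k<r. M k k)" by simp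
    then show ?thesis
      using M[OF i] unfolding sum_square_split[where M = "\<lambda>k l. M k l * (\<xi> k i * \<xi> l i)"]
      by (simp add: \<alpha>_def algebra_simps)
  qed
  have z: "\<alpha> = 0" "\<And>k l. k < l \<Longrightarrow> l < r \<Longrightarrow> M k l + M l k = 0"
    using schur[unfolded schur_independent_def, rule_format, of \<alpha> "\<lambda>k l. M k l + M l k"] *
    by blast+
  show "(\<Sum>k<r. M k k) = \<beta>" using z(1) unfolding \<alpha>_def by simp
  show "M k l + M l k = 0" if "k < r" "l < r" "k \<noteq> l"
    using z(2)[of k l] z(2)[of l k] that by (cases "k < l") (auto simp: add.commute)
qed

text \<open>Multiplying a linear relation by \<open>\<xi> m\<close> turns it into a quadratic one whose trace is \<open>a m\<close>.\<close>

lemma schur_independent_linear: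
  assumes "sign_family n r \<xi>" "schur_independent n r \<xi>"
    and a: "\<forall>i<n. (\<Sum>k<r. a k * \<xi> k i) = 0" and m: "m < r"
  shows "a m = (0::real)"
proof -
  define M where "M k l = (if l = m then a k else 0)" for k l
  have "(\<Sum>k<r. \<Sum>l<r. M k l * (\<xi> k i * \<xi> l i)) = 0" if "i < n" for i
  proof -
    have "(\<Sum>k<r. \<Sum>l<r. M k l * (\<xi> k i * \<xi> l i))
        = (\<Sum>k<r. \<Sum>l<r. if l = m then a k * \<xi> k i * \<xi> m i else 0)"
      unfolding M_def by (intro sum.cong) auto
    also have "\<dots> = (\<Sum>k<r. a k * \<xi> k i) * \<xi> m i" using m by (simp add: sum_distrib_right)
    finally show ?thesis using a that by simp
  qed
  then have "(\<Sum>k<r. M k k) = 0" by (rule schur_independent_quadratic(1)[OF assms(1,2)])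
  moreover have "(\<Sum>k<r. M k k) = a m" unfolding M_def using m by simp
  ultimately show ?thesis by simp
qed

lemma schur_independent_dual:
  assumes "sign_family n r \<xi>" "schur_independent n r \<xi>"
  obtains v where "\<And>k l. k < r \<Longrightarrow> l < r \<Longrightarrow> vec_inner n (v k) (\<xi> l) = (if k = l then 1 else 0)"
proof -
  have "\<exists>v. \<forall>k\<in>{..<r}. \<forall>l\<in>{..<r}. vec_inner n (v k) (\<xi> l) = (if k = l then 1 else 0)"
    using schur_independent_linear[OF assms] by (intro exists_dual_family) simp_all
  then show thesis using that by (meson lessThan_iff)
qed

text \<open>The dual vectors also separate the matrices: \<open>qform n X (v k) (v k)\<close> is one at \<open>X = outer (\<xi> k)\<close> and
zero at the other members.\<close>

lemma outer_family_independent: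
  assumes v: "\<And>k l. k < r \<Longrightarrow> l < r \<Longrightarrow> vec_inner n (v k) (\<xi> l) = (if k = l then 1 else 0)"
  shows "inj_on (\<lambda>k. outer (\<xi> k)) {..<r}" and "independent ((\<lambda>k. outer (\<xi> k)) ` {..<r})"
proof -
  have pair: "qform n (outer (\<xi> l)) (v k) (v k) = (if k = l then 1 else 0)" if "k < r" "l < r" for k l
    using v[OF that] by (simp add: qform_outer vec_inner_commute[of n "\<xi> l"])
  show "inj_on (\<lambda>k. outer (\<xi> k)) {..<r}"
  proof (rule inj_onI)
    fix k l assume "k \<in> {..<r}" "l \<in> {..<r}" "outer (\<xi> k) = outer (\<xi> l)"
    then show "k = l" using pair[of k k] pair[of k l] by (auto split: if_splits)
  qed
  show "independent ((\<lambda>k. outer (\<xi> k)) ` {..<r})"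
    unfolding dependent_def
  proof (intro notI, elim bexE)
    fix X assume "X \<in> (\<lambda>k. outer (\<xi> k)) ` {..<r}"
      and X: "X \<in> span ((\<lambda>k. outer (\<xi> k)) ` {..<r} - {X})"
    then obtain k where k: "k < r" "X = outer (\<xi> k)" by auto
    have "span ((\<lambda>k. outer (\<xi> k)) ` {..<r} - {X}) \<subseteq> {Y. qform n Y (v k) (v k) = 0}"
    proof (rule span_minimal)
      show "(\<lambda>k. outer (\<xi> k)) ` {..<r} - {X} \<subseteq> {Y. qform n Y (v k) (v k) = 0}"
        using k pair by auto
      show "subspace {Y. qform n Y (v k) (v k) = 0}"
        unfolding subspace_def
        by (simp add: qform_def scaleR_fun_def algebra_simps sum.distrib flip: sum_distrib_left)
    qed
    then show False using X k pair[of k k] by auto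
  qed
qed

text \<open>Let a point \<open>s A + t B\<close> of the hull, with positive \<open>s\<close> and \<open>t\<close>, have its summands in the elliptope. Every
vector orthogonal to all \<open>\<xi> k\<close> is in the kernel of the point, hence in the kernel of \<open>A\<close>. So \<open>A\<close> is a
combination of the matrices \<open>\<xi> k (\<xi> l)\<^sup>t\<close>, and its coefficients are read off by the dual vectors: they are
the values \<open>M k l\<close> of the form of \<open>A\<close> at \<open>v k\<close> and \<open>v l\<close>. The unit diagonal of \<open>A\<close> is a quadratic relation
among the signs, which forces the off-diagonal coefficients to vanish and the diagonal ones to sum
to one. The latter are nonnegative, so \<open>A\<close> is in the hull.\<close>

lemma convex_hull_outer_face_of_elliptope:
  assumes sgn: "sign_family n r \<xi>" and schur: "schur_independent n r \<xi>"
    and v: "\<And>k l. k < r \<Longrightarrow> l < r \<Longrightarrow> vec_inner n (v k) (\<xi> l) = (if k = l then 1 else 0)"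
  shows "convex hull ((\<lambda>k. outer (\<xi> k)) ` {..<r}) face_of elliptope n"
proof -
  let ?F = "convex hull ((\<lambda>k. outer (\<xi> k)) ` {..<r})"
  have sub: "?F \<subseteq> elliptope n"
    using outer_in_elliptope[OF sgn] by (intro hull_minimal convex_elliptope) auto
  have kernel: "qform n X w w = 0"
    if X: "X \<in> ?F" and w: "\<And>k. k < r \<Longrightarrow> vec_inner n (\<xi> k) w = 0" for X w
  proof -
    have "?F \<subseteq> {Y. qform n Y w w = 0}"
    proof (rule hull_minimal)
      show "(\<lambda>k. outer (\<xi> k)) ` {..<r} \<subseteq> {Y. qform n Y w w = 0}"
        using w by (auto simp: qform_outer)
      have "s *\<^sub>R Y + t *\<^sub>R Z = (\<lambda>i j. s * Y i j + t * Z i j)" for s t and Y Z :: rmat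
        by (simp add: fun_eq_iff scaleR_fun_def)
      then show "convex {Y. qform n Y w w = 0}"
        by (auto simp: convex_def qform_matrix)
    qed
    then show ?thesis using X by auto
  qed
  have main: "A \<in> ?F"
    if A: "A \<in> elliptope n" and B: "B \<in> elliptope n"
      and X: "s *\<^sub>R A + t *\<^sub>R B \<in> ?F" and st: "0 < s" "0 < t" for A B s t
  proof -
    have psd: "psd_matrix n A" and sym: "symmetric_matrix n A" and pos: "\<And>w. 0 \<le> qform n A w w"
      and posB: "\<And>w. 0 \<le> qform n B w w"
      and sq: "square_matrix n A" and diag: "\<And>i. i < n \<Longrightarrow> A i i = 1"
      using A B unfolding elliptope_def psd_matrix_iff by auto
    have null: "qform n A u w = 0" if w: "\<And>k. k < r \<Longrightarrow> vec_inner n (\<xi> k) w = 0" for u w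
    proof -
      have "s *\<^sub>R A + t *\<^sub>R B = (\<lambda>i j. s * A i j + t * B i j)"
        by (simp add: fun_eq_iff scaleR_fun_def)
      then have "s * qform n A w w + t * qform n B w w = 0"
        using kernel[OF X w] by (simp add: qform_matrix)
      moreover have "0 \<le> t * qform n B w w" "0 \<le> s * qform n A w w"
        using posB pos st by simp_all
      ultimately have "s * qform n A w w = 0" by linarith
      then have "qform n A w w = 0" using st by simp
      then show ?thesis by (rule psd_matrix_kernel[OF psd])
    qed
    (* Subtracting from w its components along the dual family leaves a vector of the kernel. *)
    have right: "qform n A u w = (\<Sum>l<r. vec_inner n (\<xi> l) w * qform n A u (v l))" for u w
    proof -
      define w' where "w' = (\<lambda>i. w i - (\<Sum>l<r. vec_inner n (\<xi> l) w * v l i))"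
      have "vec_inner n (\<xi> k) w' = 0" if k: "k < r" for k
      proof -
        have "vec_inner n (\<xi> k) w' = vec_inner n w (\<xi> k) - (\<Sum>l<r. vec_inner n (\<xi> l) w * vec_inner n (v l) (\<xi> k))"
          unfolding w'_def vec_inner_commute[of n "\<xi> k"] vec_inner_linear_left by simp
        also have "(\<Sum>l<r. vec_inner n (\<xi> l) w * vec_inner n (v l) (\<xi> k))
            = (\<Sum>l<r. if l = k then vec_inner n (\<xi> k) w else 0)"
          using v k by (intro sum.cong) auto
        also have "\<dots> = vec_inner n w (\<xi> k)" using k by (simp add: vec_inner_commute)
        finally show ?thesis by simp
      qed
      then have "qform n A u w' = 0" by (rule null)
      then show ?thesis
        unfolding qform_commute[OF sym, of u] w'_def qform_linear_left by simp
    qed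
    define M where "M k l = qform n A (v k) (v l)" for k l
    have expand: "qform n A u w = (\<Sum>k<r. \<Sum>l<r. M k l * (vec_inner n (\<xi> k) u * vec_inner n (\<xi> l) w))" for u w
    proof -
      have "qform n A u w = (\<Sum>l<r. vec_inner n (\<xi> l) w * (\<Sum>k<r. vec_inner n (\<xi> k) u * qform n A (v l) (v k)))"
        using right[of u w] right[of _ u] qform_commute[OF sym, of u] by simp
      also have "\<dots> = (\<Sum>l<r. \<Sum>k<r. M k l * (vec_inner n (\<xi> k) u * vec_inner n (\<xi> l) w))"
        unfolding sum_distrib_left M_def
        by (intro sum.cong refl) (subst qform_commute[OF sym], simp add: mult_ac)
      also have "\<dots> = (\<Sum>k<r. \<Sum>l<r. M k l * (vec_inner n (\<xi> k) u * vec_inner n (\<xi> l) w))"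
        by (rule sum.swap)
      finally show ?thesis .
    qed
    have entry: "A i j = (\<Sum>k<r. \<Sum>l<r. M k l * (\<xi> k i * \<xi> l j))" if "i < n" "j < n" for i j
    proof -
      have "vec_inner n x (\<lambda>a. if a = m then 1 else 0) = x m" if "m < n" for x m
        unfolding vec_inner_def using that by (simp add: if_distrib cong: if_cong)
      then show ?thesis
        using expand[of "\<lambda>a. if a = i then 1 else 0" "\<lambda>b. if b = j then 1 else 0"] that
        by (simp add: qform_unit)
    qed
    have Mdiag: "(\<Sum>k<r. M k k) = 1"
      and off: "\<And>k l. k < r \<Longrightarrow> l < r \<Longrightarrow> k \<noteq> l \<Longrightarrow> M k l + M l k = 0"
      using schur_independent_quadratic[OF sgn schur, of M 1] entry diag by auto
    (* M is symmetric, so the vanishing of M k l + M l k is that of M k l. *)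
    have M0: "M k l = 0" if "k < r" "l < r" "k \<noteq> l" for k l
      using off[OF that] qform_commute[OF sym, of "v k" "v l"] by (simp add: M_def)
    have "A = (\<Sum>k<r. M k k *\<^sub>R outer (\<xi> k))"
    proof (intro ext)
      fix i j
      have app: "(\<Sum>k<r. M k k *\<^sub>R outer (\<xi> k)) i j = (\<Sum>k<r. M k k * (\<xi> k i * \<xi> k j))"
        by (induction r) (simp_all add: scaleR_fun_def outer_def)
      show "A i j = (\<Sum>k<r. M k k *\<^sub>R outer (\<xi> k)) i j"
      proof (cases "i < n \<and> j < n")
        case True
        then have "A i j = (\<Sum>k<r. \<Sum>l<r. if l = k then M k k * (\<xi> k i * \<xi> k j) else 0)"
          unfolding entry[OF conjunct1[OF True] conjunct2[OF True]]
          using M0 by (intro sum.cong) auto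
        also have "\<dots> = (\<Sum>k<r. M k k * (\<xi> k i * \<xi> k j))" by simp
        finally show ?thesis unfolding app .
      next
        case False
        then have "A i j = 0" using sq unfolding square_matrix_def by blast
        moreover have "(\<Sum>k<r. M k k * (\<xi> k i * \<xi> k j)) = 0"
          using False sgn unfolding sign_family_def
          by (intro sum.neutral) (auto simp: not_less)
        ultimately show ?thesis unfolding app by simp
      qed
    qed
    also have "\<dots> \<in> ?F"
    proof (rule convex_sum)
      show "M k k \<ge> 0" for k unfolding M_def by (rule pos)
      show "outer (\<xi> k) \<in> ?F" if "k \<in> {..<r}" for k using that by (intro hull_inc imageI)
      show "(\<Sum>k<r. M k k) = 1" by (rule Mdiag)
    qed (simp_all add: convex_convex_hull)
    finally show ?thesis .
  qed
  show ?thesis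
    unfolding face_of_def
  proof (intro conjI ballI impI sub convex_convex_hull)
    fix A B X
    assume AB: "A \<in> elliptope n" "B \<in> elliptope n" and X: "X \<in> ?F" "X \<in> open_segment A B"
    then obtain t where t: "0 < t" "t < 1" "X = (1 - t) *\<^sub>R A + t *\<^sub>R B"
      unfolding in_segment by blast
    show "A \<in> ?F" using main[of A B "1 - t" t] AB X t by simp
    show "B \<in> ?F" using main[of B A t "1 - t"] AB X t by (simp add: add.commute)
  qed
qed

section \<open>Common zeros at random points\<close>

lemma measure_bind_pmf_integral:
  "measure_pmf.prob (bind_pmf M f) S = (\<integral>x. measure_pmf.prob (f x) S \<partial>measure_pmf M)"
proof -
  have "ennreal (measure_pmf.prob (bind_pmf M f) S) = (\<integral>\<^sup>+x. ennreal (measure_pmf.prob (f x) S) \<partial>measure_pmf M)"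
    by (simp flip: measure_pmf.emeasure_eq_measure)
  also have "\<dots> = ennreal (\<integral>x. measure_pmf.prob (f x) S \<partial>measure_pmf M)"
    by (intro nn_integral_eq_integral measure_pmf.integrable_const_bound[where B = 1]) auto
  finally show ?thesis by (simp add: integral_nonneg_AE)
qed

lemma prob_Pi_pmf_insert:
  assumes "finite A" "a \<notin> A"
  shows "measure_pmf.prob (Pi_pmf (insert a A) d p) S =
    (\<integral>x. measure_pmf.prob (Pi_pmf A d p) {y. y(a := x) \<in> S} \<partial>measure_pmf (p a))"
proof -
  have "Pi_pmf (insert a A) d p = bind_pmf (p a) (\<lambda>x. map_pmf (\<lambda>y. y(a := x)) (Pi_pmf A d p))"
    using Pi_pmf_insert'[OF assms] by (simp add: map_pmf_def)
  then show ?thesis by (simp add: measure_bind_pmf_integral vimage_def)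
qed

text \<open>One step of Gaussian elimination. Subtracting from every \<open>g\<close> the multiple of \<open>b\<close> that makes it
vanish at \<open>x\<close> is a linear map that kills \<open>b\<close> and fixes all functions vanishing at \<open>x\<close>. So
its image of the remaining generators spans all functions of the space with a zero at \<open>x\<close>.\<close>

lemma span_vanishing_subset:
  fixes B :: "('a \<Rightarrow> real) set"
  assumes "finite B" "b \<in> B" "b x \<noteq> 0"
  obtains B' where "finite B'" "card B' < card B" "B' \<subseteq> span B"
    "\<And>f. f \<in> span B \<Longrightarrow> f x = 0 \<Longrightarrow> f \<in> span B'"
proof
  define e where "e g = g - (g x / b x) *\<^sub>R b" for g :: "'a \<Rightarrow> real"
  define B' where "B' = e ` (B - {b})"
  show "finite B'" unfolding B'_def using assms by simp
  have "card B' \<le> card (B - {b})" unfolding B'_def using assms by (intro card_image_le) auto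
  also have "\<dots> < card B" using assms by (intro card_Diff1_less)
  finally show "card B' < card B" .
  show "B' \<subseteq> span B"
    unfolding B'_def e_def using assms by (auto intro: span_diff span_scale span_base)
  have e_lin: "e (g + h) = e g + e h" "e (c *\<^sub>R g) = c *\<^sub>R e g" "e 0 = 0" for g h c
    unfolding e_def by (auto simp: fun_eq_iff scaleR_fun_def field_simps add_divide_distrib)
  have "subspace {g. e g \<in> span B'}"
    by (auto simp: subspace_def e_lin span_add span_scale span_zero)
  moreover have "e b = 0" unfolding e_def using assms by simp
  then have "e g \<in> span B'" if "g \<in> B" for g
    using that by (cases "g = b") (auto simp: span_zero B'_def intro!: span_base)
  then have "B \<subseteq> {g. e g \<in> span B'}" by blast
  ultimately have "span B \<subseteq> {g. e g \<in> span B'}" by (intro span_minimal)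
  then show "f \<in> span B'" if "f \<in> span B" "f x = 0" for f
    using that unfolding e_def by auto
qed

text \<open>Consider the space of those functions that vanish at all sample points seen so far. As long as
it is nonzero, with probability at least \<open>q\<close> some member is nonzero at the next point. In that case
the space loses a generator, which multiplies the bound \<open>exp (s * (card B - 1))\<close> by \<open>exp (- s)\<close>;
otherwise nothing changes. On average a point therefore contributes the factor \<open>1 - q * (1 - exp (- s))\<close>. This is the Chernoff
bound with parameter \<open>s\<close> for the event that fewer than \<open>card B\<close> of the points are successful, without
having to describe that random number. The induction treats the spanning set as variable, because
the first point replaces it by a smaller one.\<close>

lemma prob_common_zero_le:
  fixes \<mu> :: "'a pmf" and B :: "('a \<Rightarrow> real) set"
  assumes "finite A" and "finite B"
    and "0 \<le> q" and "q \<le> 1" and "0 \<le> s"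
    and small_ball: "\<And>f. f \<in> span B \<Longrightarrow> f \<noteq> 0 \<Longrightarrow> q \<le> measure_pmf.prob \<mu> {x. f x \<noteq> 0}"
  shows "measure_pmf.prob (Pi_pmf A d (\<lambda>_. \<mu>)) {y. \<exists>f\<in>span B. f \<noteq> 0 \<and> (\<forall>i\<in>A. f (y i) = 0)}
    \<le> exp (s * (real (card B) - 1)) * (1 - q * (1 - exp (- s))) ^ card A"
  using assms(1,2) small_ball
proof (induction A arbitrary: B rule: finite_induct)
  case empty
  show ?case
  proof (cases "B = {}")
    case True
    then show ?thesis by simp
  next
    case False
    then have "1 \<le> card B" using empty by (simp add: Suc_le_eq card_gt_0_iff)
    then have "1 \<le> exp (s * (real (card B) - 1))" using \<open>0 \<le> s\<close> by simp
    then show ?thesis by (simp add: order_trans[OF measure_pmf.prob_le_1])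
  qed
next
  case (insert a A)
  define \<rho> where "\<rho> = 1 - q * (1 - exp (- s))"
  define Z where "Z B y = (\<exists>f\<in>span B. f \<noteq> 0 \<and> (\<forall>i\<in>A. f (y i) = 0))" for B :: "('a \<Rightarrow> real) set" and y
  define g where "g = exp (s * (real (card B) - 1))"
  (* The values of the sample at a for which the space loses a generator. *)
  define E where "E = {x. \<exists>b\<in>B. b x \<noteq> 0}"
  have "q * (1 - exp (- s)) \<le> 1 * 1" using assms by (intro mult_mono) auto
  then have \<rho>: "0 \<le> \<rho>" unfolding \<rho>_def by simp
  let ?S = "{y. \<exists>f\<in>span B. f \<noteq> 0 \<and> (\<forall>i\<in>insert a A. f (y i) = 0)}"
  let ?P = "Pi_pmf A d (\<lambda>_. \<mu>)"
  show ?case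
  proof (cases "\<exists>f\<in>span B. f \<noteq> 0")
    case False
    then have "?S = {}" by auto
    then have "measure_pmf.prob (Pi_pmf (insert a A) d (\<lambda>_. \<mu>)) ?S = 0"
      by (simp only: measure_empty)
    also have "0 \<le> g * \<rho> ^ card (insert a A)" using \<rho> by (simp add: g_def)
    finally show ?thesis unfolding g_def \<rho>_def .
  next
    case True
    then obtain f where f: "f \<in> span B" "f \<noteq> 0" by blast
    have "f x = 0" if "x \<notin> E" for x
    proof -
      have "span B \<subseteq> {h. h x = 0}"
        using that by (intro span_minimal) (auto simp: E_def subspace_def scaleR_fun_def)
      then show ?thesis using f by auto
    qed
    then have "measure_pmf.prob \<mu> {x. f x \<noteq> 0} \<le> measure_pmf.prob \<mu> E"
      by (intro measure_pmf.finite_measure_mono) auto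
    then have qE: "q \<le> measure_pmf.prob \<mu> E" using insert.prems(2)[OF f] by linarith
    have int_E: "integrable (measure_pmf \<mu>) (indicator E :: 'a \<Rightarrow> real)"
      by (intro measure_pmf.integrable_const_bound[where B = 1]) auto
    have step: "measure_pmf.prob ?P {y. y(a := x) \<in> ?S} \<le> g * \<rho> ^ card A * (1 - (1 - exp (- s)) * indicator E x)" for x
    proof (cases "x \<in> E")
      case True
      then obtain b where b: "b \<in> B" "b x \<noteq> 0" unfolding E_def by auto
      obtain B' where B': "finite B'" "card B' < card B" "B' \<subseteq> span B"
        "\<And>f. f \<in> span B \<Longrightarrow> f x = 0 \<Longrightarrow> f \<in> span B'"
        using span_vanishing_subset[of B b x] b insert.prems(1) by metis
      have sub: "span B' \<subseteq> span B" using B'(3) by (simp add: span_minimal)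
      have "{y. y(a := x) \<in> ?S} \<subseteq> {y. Z B' y}"
        unfolding Z_def using B'(4) insert.hyps(2) by (fastforce split: if_splits)
      then have "measure_pmf.prob ?P {y. y(a := x) \<in> ?S} \<le> measure_pmf.prob ?P {y. Z B' y}"
        by (intro measure_pmf.finite_measure_mono) auto
      also have "\<dots> \<le> exp (s * (real (card B') - 1)) * \<rho> ^ card A"
        unfolding Z_def \<rho>_def using B'(1) sub insert.prems(2) by (intro insert.IH) auto
      also have "\<dots> \<le> exp (s * (real (card B) - 1) - s) * \<rho> ^ card A"
      proof (intro mult_right_mono)
        have "s * (real (card B') - 1) \<le> s * (real (card B) - 1 - 1)"
          using B'(2) \<open>0 \<le> s\<close> by (intro mult_left_mono) auto
        then show "exp (s * (real (card B') - 1)) \<le> exp (s * (real (card B) - 1) - s)"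
          by (simp add: algebra_simps)
      qed (use \<rho> in simp)
      also have "\<dots> = g * \<rho> ^ card A * (1 - (1 - exp (- s)) * indicator E x)"
      proof -
        have "exp (s * (real (card B) - 1) - s) = g * exp (- s)"
          unfolding g_def by (simp flip: exp_add)
        then show ?thesis using True by simp
      qed
      finally show ?thesis .
    next
      case False
      have "{y. y(a := x) \<in> ?S} \<subseteq> {y. Z B y}"
        unfolding Z_def using insert.hyps(2) by (fastforce split: if_splits)
      then have "measure_pmf.prob ?P {y. y(a := x) \<in> ?S} \<le> measure_pmf.prob ?P {y. Z B y}"
        by (intro measure_pmf.finite_measure_mono) auto
      also have "\<dots> \<le> g * \<rho> ^ card A"
        unfolding Z_def \<rho>_def g_def using insert.prems by (intro insert.IH) auto
      finally show ?thesis using False by simp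
    qed
    have "measure_pmf.prob (Pi_pmf (insert a A) d (\<lambda>_. \<mu>)) ?S
        = (\<integral>x. measure_pmf.prob ?P {y. y(a := x) \<in> ?S} \<partial>measure_pmf \<mu>)"
      using insert.hyps by (rule prob_Pi_pmf_insert)
    also have "\<dots> \<le> (\<integral>x. g * \<rho> ^ card A * (1 - (1 - exp (- s)) * indicator E x) \<partial>measure_pmf \<mu>)"
    proof (intro integral_mono step)
      show "integrable (measure_pmf \<mu>) (\<lambda>x. measure_pmf.prob ?P {y. y(a := x) \<in> ?S})"
        by (intro measure_pmf.integrable_const_bound[where B = 1]) auto
      show "integrable (measure_pmf \<mu>) (\<lambda>x. g * \<rho> ^ card A * (1 - (1 - exp (- s)) * indicator E x))"
        by (intro integrable_mult_right Bochner_Integration.integrable_diff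
            measure_pmf.integrable_const int_E)
    qed
    also have "\<dots> = g * \<rho> ^ card A * (1 - (1 - exp (- s)) * measure_pmf.prob \<mu> E)"
      using int_E by simp
    also have "\<dots> \<le> g * \<rho> ^ card A * \<rho>"
    proof (intro mult_left_mono)
      have "(1 - exp (- s)) * q \<le> (1 - exp (- s)) * measure_pmf.prob \<mu> E"
        using qE \<open>0 \<le> s\<close> by (intro mult_left_mono) auto
      then show "1 - (1 - exp (- s)) * measure_pmf.prob \<mu> E \<le> \<rho>"
        unfolding \<rho>_def by (simp add: mult.commute)
    qed (use \<rho> in \<open>simp add: g_def\<close>)
    also have "g * \<rho> ^ card A * \<rho> = g * \<rho> ^ card (insert a A)"
      using insert.hyps by (simp add: mult_ac)
    finally show ?thesis unfolding g_def \<rho>_def .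
  qed
qed

section \<open>Quadratic functions of random signs\<close>

lemma integral_SBern:
  fixes f :: "real \<Rightarrow> real"
  assumes "0 \<le> p" "p \<le> 1"
  shows "(\<integral>x. f x \<partial>measure_pmf (SBern p)) = p * f 1 + (1 - p) * f (- 1)"
  unfolding SBern_def using assms by simp

lemma set_SBern_subset: "set_pmf (SBern p) \<subseteq> {1, -1}"
  unfolding SBern_def by auto

text \<open>Twice the discrete partial derivative on the cube. It lowers the degree of a multilinear polynomial
by one.\<close>

definition sign_diff :: "nat \<Rightarrow> (rvec \<Rightarrow> real) \<Rightarrow> rvec \<Rightarrow> real"
  where "sign_diff k f x = f (x(k := 1)) - f (x(k := - 1))"

text \<open>If the difference in direction \<open>k\<close> is nonzero at \<open>x\<close>, then \<open>f\<close> is nonzero for at least one choice of the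
sign \<open>x k\<close>. The difference does not depend on that sign, which is drawn independently and takes either
value with probability at least \<open>p * (1 - p)\<close>.\<close>

lemma prob_nonzero_ge_sign_diff:
  assumes "finite A" "k \<in> A" and p: "0 \<le> p" "p \<le> 1"
  shows "p * (1 - p) * measure_pmf.prob (Pi_pmf A 0 (\<lambda>_. SBern p)) {x. sign_diff k f x \<noteq> 0}
    \<le> measure_pmf.prob (Pi_pmf A 0 (\<lambda>_. SBern p)) {x. f x \<noteq> 0}"
proof -
  define \<nu> where "\<nu> = Pi_pmf (A - {k}) 0 (\<lambda>_. SBern p)"
  define U where "U s = {y. f (y(k := s)) \<noteq> 0}" for s
  define V where "V = {y. sign_diff k f y \<noteq> 0}"
  have split: "measure_pmf.prob (Pi_pmf A 0 (\<lambda>_. SBern p)) S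
      = p * measure_pmf.prob \<nu> {y. y(k := 1) \<in> S} + (1 - p) * measure_pmf.prob \<nu> {y. y(k := - 1) \<in> S}"
    for S
    using prob_Pi_pmf_insert[of "A - {k}" k 0 "\<lambda>_. SBern p" S] assms
    by (simp add: insert_absorb integral_SBern \<nu>_def)
  have "measure_pmf.prob (Pi_pmf A 0 (\<lambda>_. SBern p)) {x. sign_diff k f x \<noteq> 0} = measure_pmf.prob \<nu> V"
    unfolding split by (simp add: sign_diff_def V_def algebra_simps)
  also have "\<dots> \<le> measure_pmf.prob \<nu> (U 1 \<union> U (- 1))"
    by (intro measure_pmf.finite_measure_mono) (auto simp: U_def V_def sign_diff_def)
  also have "\<dots> \<le> measure_pmf.prob \<nu> (U 1) + measure_pmf.prob \<nu> (U (- 1))"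
    by (rule measure_Un_le) auto
  finally have "p * (1 - p) * measure_pmf.prob (Pi_pmf A 0 (\<lambda>_. SBern p)) {x. sign_diff k f x \<noteq> 0}
      \<le> p * (1 - p) * (measure_pmf.prob \<nu> (U 1) + measure_pmf.prob \<nu> (U (- 1)))"
    using p by (intro mult_left_mono) auto
  also have "\<dots> = p * (1 - p) * measure_pmf.prob \<nu> (U 1) + p * (1 - p) * measure_pmf.prob \<nu> (U (- 1))"
    by (simp add: algebra_simps)
  also have "\<dots> \<le> p * measure_pmf.prob \<nu> (U 1) + (1 - p) * measure_pmf.prob \<nu> (U (- 1))"
    using p by (intro add_mono mult_right_mono mult_left_le mult_left_le_one_le) auto
  also have "\<dots> = measure_pmf.prob (Pi_pmf A 0 (\<lambda>_. SBern p)) {x. f x \<noteq> 0}"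
    unfolding split by (simp add: U_def)
  finally show ?thesis .
qed

text \<open>Squares are left out because they are constant on sign vectors.\<close>

definition quad :: "nat \<Rightarrow> real \<Rightarrow> (nat \<Rightarrow> nat \<Rightarrow> real) \<Rightarrow> rvec \<Rightarrow> real"
  where "quad r \<alpha> c x = \<alpha> + (\<Sum>l<r. \<Sum>k<l. c k l * (x k * x l))"

lemma schur_independent_iff_quad:
  "schur_independent n r \<xi> \<longleftrightarrow>
    (\<forall>\<alpha> c. (\<forall>i<n. quad r \<alpha> c (\<lambda>k. \<xi> k i) = 0) \<longrightarrow> \<alpha> = 0 \<and> (\<forall>l<r. \<forall>k<l. c k l = 0))"
  unfolding schur_independent_def quad_def ..

lemma sign_diff_sign_diff_quad:
  assumes "k < l" "l < r"
  shows "sign_diff l (sign_diff k (quad r \<alpha> c)) x = 4 * c k l"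
proof -
  define m where "m a b s t = (x(l := t, k := s)) a * (x(l := t, k := s)) b" for a b :: nat and s t :: real
  have "sign_diff l (sign_diff k (quad r \<alpha> c)) x
    = (\<Sum>b<r. \<Sum>a<b. c a b * (m a b 1 1 - m a b (- 1) 1 - m a b 1 (- 1) + m a b (- 1) (- 1)))"
    unfolding sign_diff_def quad_def m_def
    by (simp only: sum.distrib sum_subtractf right_diff_distrib distrib_left)
  also have "\<dots> = (\<Sum>b<r. \<Sum>a<b. if b = l then (if a = k then 4 * c a b else 0) else 0)"
    using assms by (intro sum.cong refl) (auto simp: m_def)
  also have "\<dots> = (\<Sum>b<r. if b = l then 4 * c k b else 0)"
    using assms by (intro sum.cong) auto
  also have "\<dots> = 4 * c k l" using assms by simp
  finally show ?thesis .
qed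

lemma quad_eq_0:
  assumes "quad r \<alpha> c = 0"
  shows "\<alpha> = 0" and "k < l \<Longrightarrow> l < r \<Longrightarrow> c k l = 0"
proof -
  have "quad r \<alpha> c (\<lambda>_. 0) = 0" unfolding assms by simp
  then show "\<alpha> = 0" by (simp add: quad_def)
  show "c k l = 0" if "k < l" "l < r"
    using sign_diff_sign_diff_quad[OF that, of \<alpha> c "\<lambda>_. 0"] unfolding assms
    by (simp add: sign_diff_def)
qed

text \<open>A nonconstant function of this kind has a nonzero coefficient \<open>c k l\<close>, and differencing in the two
directions \<open>k\<close> and \<open>l\<close> leaves the nonzero constant \<open>4 * c k l\<close>. Each difference costs a factor
\<open>p * (1 - p)\<close>.\<close>

lemma prob_quad_nonzero_ge:
  assumes p: "0 \<le> p" "p \<le> 1" and nz: "quad r \<alpha> c \<noteq> 0"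
  shows "p\<^sup>2 * (1 - p)\<^sup>2 \<le> measure_pmf.prob (Pi_pmf {..<r} 0 (\<lambda>_. SBern p)) {x. quad r \<alpha> c x \<noteq> 0}"
    (is "_ \<le> ?P (quad r \<alpha> c)")
proof (cases "\<exists>k l. k < l \<and> l < r \<and> c k l \<noteq> 0")
  case True
  then obtain k l where kl: "k < l" "l < r" "c k l \<noteq> 0" by blast
  have "p * (1 - p) = p * (1 - p) * ?P (sign_diff l (sign_diff k (quad r \<alpha> c)))"
    using kl by (simp add: sign_diff_sign_diff_quad)
  also have "\<dots> \<le> ?P (sign_diff k (quad r \<alpha> c))"
    using kl p by (intro prob_nonzero_ge_sign_diff) auto
  finally have "p * (1 - p) * (p * (1 - p)) \<le> p * (1 - p) * ?P (sign_diff k (quad r \<alpha> c))"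
    using p by (intro mult_left_mono) auto
  also have "\<dots> \<le> ?P (quad r \<alpha> c)"
    using kl p by (intro prob_nonzero_ge_sign_diff) auto
  finally show ?thesis by (simp add: power2_eq_square mult_ac)
next
  case False
  have const: "quad r \<alpha> c x = \<alpha>" for x
    using False unfolding quad_def by simp
  then have "\<alpha> \<noteq> 0" using nz by (auto simp: fun_eq_iff)
  then have "?P (quad r \<alpha> c) = 1" by (simp add: const)
  moreover have "p\<^sup>2 * (1 - p)\<^sup>2 \<le> 1 * 1"
    using p by (intro mult_mono power_le_one) auto
  ultimately show ?thesis by simp
qed

definition quad_basis :: "nat \<Rightarrow> (rvec \<Rightarrow> real) set"
  where "quad_basis r =
    insert (\<lambda>_. 1) ((\<lambda>(k, l) x. x k * x l) ` {(k, l). k < l \<and> l < r})"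

text \<open>The exact cardinality is \<open>1 + r (r - 1) / 2\<close>. The cruder bound only affects the constant of the final
estimate, through the parameter of the exponential moment.\<close>

lemma finite_quad_basis: "finite (quad_basis r)"
  and card_quad_basis_le: "card (quad_basis r) \<le> r\<^sup>2 + 1"
proof -
  have sub: "{(k, l). k < l \<and> l < r} \<subseteq> {..<r} \<times> {..<r}" by auto
  then have fin: "finite {(k, l). k < l \<and> l < r}" by (rule finite_subset) auto
  show "finite (quad_basis r)" unfolding quad_basis_def using fin by simp
  have "card {(k, l). k < l \<and> l < r} \<le> r\<^sup>2"
    using card_mono[OF _ sub] by (simp add: power2_eq_square)
  then have "card ((\<lambda>(k, l) (x :: rvec). x k * x l) ` {(k, l). k < l \<and> l < r}) \<le> r\<^sup>2"
    using card_image_le[OF fin] by (rule order.trans[rotated])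
  then show "card (quad_basis r) \<le> r\<^sup>2 + 1"
    unfolding quad_basis_def by (intro card_insert_le_m1) simp_all
qed

lemma span_quad_basis: "span (quad_basis r) = {f. \<exists>\<alpha> c. f = quad r \<alpha> c}"
proof
  show "span (quad_basis r) \<subseteq> {f. \<exists>\<alpha> c. f = quad r \<alpha> c}"
  proof (rule span_minimal)
    have "\<exists>\<alpha> c. (\<lambda>_. 1) = quad r \<alpha> c"
      by (rule exI[of _ 1], rule exI[of _ "\<lambda>_ _. 0"]) (simp add: quad_def fun_eq_iff)
    moreover have "\<exists>\<alpha> c. (\<lambda>x. x k * x l) = quad r \<alpha> c" if kl: "k < l" "l < r" for k l
    proof (rule exI[of _ 0], rule exI[of _ "\<lambda>a b. if b = l then if a = k then 1 else 0 else 0"], rule ext)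
      fix x :: rvec
      have "quad r 0 (\<lambda>a b. if b = l then if a = k then 1 else 0 else 0) x
          = (\<Sum>b<r. \<Sum>a<b. if b = l then if a = k then x k * x l else 0 else 0)"
        unfolding quad_def by (auto intro!: sum.cong)
      also have "\<dots> = (\<Sum>b<r. if b = l then x k * x l else 0)"
        using kl by (intro sum.cong) auto
      also have "\<dots> = x k * x l" using kl by simp
      finally show "x k * x l = quad r 0 (\<lambda>a b. if b = l then if a = k then 1 else 0 else 0) x" ..
    qed
    ultimately show "quad_basis r \<subseteq> {f. \<exists>\<alpha> c. f = quad r \<alpha> c}"
      unfolding quad_basis_def by auto
    have "quad r 0 (\<lambda>_ _. 0) = 0" by (simp add: quad_def fun_eq_iff)
    moreover have "quad r \<alpha> c + quad r \<beta> d = quad r (\<alpha> + \<beta>) (\<lambda>k l. c k l + d k l)" for \<alpha> \<beta> c d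
      by (simp add: quad_def fun_eq_iff sum.distrib algebra_simps)
    moreover have "t *\<^sub>R quad r \<alpha> c = quad r (t * \<alpha>) (\<lambda>k l. t * c k l)" for t \<alpha> c
      by (simp add: quad_def fun_eq_iff scaleR_fun_def sum_distrib_left algebra_simps)
    ultimately show "subspace {f. \<exists>\<alpha> c. f = quad r \<alpha> c}"
      unfolding subspace_def by (auto, metis+)
  qed
next
  have sum_app: "(\<Sum>i\<in>I. g i) x = (\<Sum>i\<in>I. g i x)" for I :: "nat set" and g :: "nat \<Rightarrow> rvec \<Rightarrow> real" and x
    by (induction I rule: infinite_finite_induct) auto
  have eq: "quad r \<alpha> c = \<alpha> *\<^sub>R (\<lambda>_. 1) + (\<Sum>l<r. \<Sum>k<l. c k l *\<^sub>R (\<lambda>x. x k * x l))" for \<alpha> c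
    by (simp add: fun_eq_iff quad_def scaleR_fun_def sum_app)
  have "quad r \<alpha> c \<in> span (quad_basis r)" for \<alpha> c
    unfolding eq
    by (intro span_add span_sum span_scale span_base) (auto simp: quad_basis_def)
  then show "{f. \<exists>\<alpha> c. f = quad r \<alpha> c} \<subseteq> span (quad_basis r)" by blast
qed

section \<open>The random face\<close>

lemma pmf_Pi_pmf_Pi_pmf:
  assumes "finite A" "finite B"
  shows "pmf (Pi_pmf A (\<lambda>_. d) (\<lambda>a. Pi_pmf B d (p a))) x =
    (if \<forall>a b. a \<notin> A \<or> b \<notin> B \<longrightarrow> x a b = d then \<Prod>a\<in>A. \<Prod>b\<in>B. pmf (p a b) (x a b) else 0)"
proof (cases "\<forall>a b. a \<notin> A \<or> b \<notin> B \<longrightarrow> x a b = d")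
  case True
  then show ?thesis using assms by (auto simp: pmf_Pi fun_eq_iff intro!: prod.cong)
next
  case False
  then obtain a b where ab: "a \<notin> A \<or> b \<notin> B" "x a b \<noteq> d" by blast
  show ?thesis
  proof (cases "a \<in> A")
    case True
    then have "pmf (Pi_pmf B d (p a)) (x a) = 0" using ab assms by (auto simp: pmf_Pi)
    then have "(\<Prod>a\<in>A. pmf (Pi_pmf B d (p a)) (x a)) = 0"
      using True assms(1) by (intro prod_zero) auto
    then show ?thesis unfolding if_not_P[OF False] pmf_Pi[OF assms(1)] by simp
  next
    case a: False
    then have "x a \<noteq> (\<lambda>_. d)" using ab by auto
    then show ?thesis unfolding if_not_P[OF False] pmf_Pi[OF assms(1)] using a by auto
  qed
qed

text \<open>A random matrix with independent entries may be drawn column by column or row by row: in both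
cases its probability is the product over all entries, and the products may be exchanged.\<close>

lemma Pi_pmf_flip:
  fixes A :: "'a set" and B :: "'b set" and d :: 'c
  assumes "finite A" "finite B"
  shows "map_pmf (\<lambda>x b a. x a b) (Pi_pmf A (\<lambda>_. d) (\<lambda>a. Pi_pmf B d (p a))) =
    Pi_pmf B (\<lambda>_. d) (\<lambda>b. Pi_pmf A d (\<lambda>a. p a b))"
proof (rule pmf_eqI)
  fix y :: "'b \<Rightarrow> 'a \<Rightarrow> 'c"
  have inj: "inj (\<lambda>x b a. x a b)" by (auto simp: inj_def fun_eq_iff)
  have eq: "pmf (map_pmf (\<lambda>x b a. x a b) M) y = pmf M (\<lambda>a b. y b a)" for M
    using pmf_map_inj'[OF inj, of M "\<lambda>a b. y b a"] .
  have support: "(\<forall>a b. a \<notin> A \<or> b \<notin> B \<longrightarrow> y b a = d) \<longleftrightarrow> (\<forall>b a. b \<notin> B \<or> a \<notin> A \<longrightarrow> y b a = d)"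
    by blast
  show "pmf (map_pmf (\<lambda>x b a. x a b) (Pi_pmf A (\<lambda>_. d) (\<lambda>a. Pi_pmf B d (p a)))) y =
    pmf (Pi_pmf B (\<lambda>_. d) (\<lambda>b. Pi_pmf A d (\<lambda>a. p a b))) y"
    unfolding eq pmf_Pi_pmf_Pi_pmf[OF assms] pmf_Pi_pmf_Pi_pmf[OF assms(2,1)]
    by (rule if_cong[OF support prod.swap refl])
qed

definition sign_sample :: "real \<Rightarrow> nat \<Rightarrow> nat \<Rightarrow> (nat \<Rightarrow> rvec) pmf"
  where "sign_sample p r n = Pi_pmf {..<r} 0 (\<lambda>_. SBern_vec p n)"

lemma sign_family_sample:
  assumes "\<xi> \<in> set_pmf (sign_sample p r n)"
  shows "sign_family n r \<xi>"
  using assms set_SBern_subset[of p] unfolding sign_sample_def SBern_vec_def sign_family_def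
  by (auto simp: set_Pi_pmf PiE_dflt_def)

text \<open>Row by row, the sample consists of \<open>n\<close> independent points of the cube \<open>{1, -1}\<^sup>r\<close>, and Schur independence
fails exactly when a nonzero function in the span of \<open>quad_basis r\<close> vanishes at all of them.\<close>

lemma prob_not_schur_independent_le:
  assumes p: "0 \<le> p" "p \<le> 1"
  shows "measure_pmf.prob (sign_sample p r n) {\<xi>. \<not> schur_independent n r \<xi>}
    \<le> exp (((real r)\<^sup>2 - 4 / 5 * p\<^sup>2 * (1 - p)\<^sup>2 * real n) / 4)"
proof -
  define q where "q = p\<^sup>2 * (1 - p)\<^sup>2"
  define \<mu> where "\<mu> = Pi_pmf {..<r} 0 (\<lambda>_. SBern p)"
  define Z where "Z = {y. \<exists>f\<in>span (quad_basis r). f \<noteq> 0 \<and> (\<forall>i\<in>{..<n}. f (y i) = 0)}"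
  have q: "0 \<le> q" "q \<le> 1"
    using p mult_mono[of "p\<^sup>2" 1 "(1 - p)\<^sup>2" 1] by (auto simp: q_def power_le_one)
  have flip: "map_pmf (\<lambda>\<xi> i k. \<xi> k i) (sign_sample p r n) = Pi_pmf {..<n} 0 (\<lambda>_. \<mu>)"
    unfolding sign_sample_def SBern_vec_def \<mu>_def zero_fun_def by (rule Pi_pmf_flip) auto
  have "{\<xi>. \<not> schur_independent n r \<xi>} \<subseteq> (\<lambda>\<xi> i k. \<xi> k i) -` Z"
  proof
    fix \<xi> assume "\<xi> \<in> {\<xi>. \<not> schur_independent n r \<xi>}"
    then obtain \<alpha> c where ac: "\<forall>i<n. quad r \<alpha> c (\<lambda>k. \<xi> k i) = 0"
      "\<not> (\<alpha> = 0 \<and> (\<forall>l<r. \<forall>k<l. c k l = 0))"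
      unfolding schur_independent_iff_quad by blast
    then have "quad r \<alpha> c \<noteq> 0" using quad_eq_0[of r \<alpha> c] by blast
    then show "\<xi> \<in> (\<lambda>\<xi> i k. \<xi> k i) -` Z"
      using ac(1) unfolding Z_def span_quad_basis by auto
  qed
  then have "measure_pmf.prob (sign_sample p r n) {\<xi>. \<not> schur_independent n r \<xi>}
      \<le> measure_pmf.prob (sign_sample p r n) ((\<lambda>\<xi> i k. \<xi> k i) -` Z)"
    by (intro measure_pmf.finite_measure_mono) auto
  also have "\<dots> = measure_pmf.prob (Pi_pmf {..<n} 0 (\<lambda>_. \<mu>)) Z"
    unfolding flip[symmetric] by simp
  (* The parameter 1 / 4 turns the bound r^2 on the dimension into the exponent r^2 / 4. *)
  also have "\<dots> \<le> exp (1 / 4 * (real (card (quad_basis r)) - 1)) * (1 - q * (1 - exp (- (1 / 4)))) ^ card {..<n}"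
    unfolding Z_def
  proof (rule prob_common_zero_le)
    show "q \<le> measure_pmf.prob \<mu> {x. f x \<noteq> 0}" if "f \<in> span (quad_basis r)" "f \<noteq> 0" for f
      using that prob_quad_nonzero_ge[OF p] unfolding span_quad_basis q_def \<mu>_def by auto
  qed (use q finite_quad_basis in auto)
  also have "\<dots> \<le> exp ((real r)\<^sup>2 / 4) * exp (- (q / 5)) ^ n"
  proof (intro mult_mono)
    have "real (card (quad_basis r)) \<le> real (r\<^sup>2 + 1)"
      using card_quad_basis_le by (rule of_nat_mono)
    then show "exp (1 / 4 * (real (card (quad_basis r)) - 1)) \<le> exp ((real r)\<^sup>2 / 4)" by simp
    have "1 + 1 / 4 \<le> exp (1 / 4 :: real)" by (rule exp_ge_add_one_self)
    then have "exp (- (1 / 4)) \<le> (4 / 5 :: real)" by (simp add: exp_minus field_simps)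
    then have a: "1 / 5 \<le> 1 - exp (- (1 / 4 :: real))" by simp
    have "1 - q * (1 - exp (- (1 / 4))) \<le> 1 + - (q / 5)"
      using mult_left_mono[OF a q(1)] by simp
    also have "\<dots> \<le> exp (- (q / 5))" by (rule exp_ge_add_one_self)
    finally have b: "1 - q * (1 - exp (- (1 / 4))) \<le> exp (- (q / 5))" .
    have "q * (1 - exp (- (1 / 4))) \<le> 1 * 1"
      using q by (intro mult_mono) auto
    then have c: "0 \<le> 1 - q * (1 - exp (- (1 / 4)))" by simp
    show "(1 - q * (1 - exp (- (1 / 4)))) ^ card {..<n} \<le> exp (- (q / 5)) ^ n"
      using power_mono[OF b c] by simp
    show "0 \<le> (1 - q * (1 - exp (- (1 / 4)))) ^ card {..<n}" using c by simp
  qed simp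
  also have "\<dots> = exp (((real r)\<^sup>2 - 4 / 5 * q * real n) / 4)"
    unfolding exp_of_nat_mult[symmetric] exp_add[symmetric] by (simp add: field_simps)
  finally show ?thesis unfolding q_def by (simp add: mult.assoc)
qed

lemma simplicial_face_of_schur_independent:
  assumes sgn: "sign_family n r \<xi>" and schur: "schur_independent n r \<xi>" and r: "1 \<le> r"
  defines "F \<equiv> convex hull ((\<lambda>k. outer (\<xi> k)) ` {..<r})"
  shows "simplicial_face_of F (elliptope n)" and "affine_dim F = r - 1"
proof -
  let ?V = "(\<lambda>k. outer (\<xi> k)) ` {..<r}"
  obtain v where v: "\<And>k l. k < r \<Longrightarrow> l < r \<Longrightarrow> vec_inner n (v k) (\<xi> l) = (if k = l then 1 else 0)"
    using schur_independent_dual[OF sgn schur] by blast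
  have ne: "?V \<noteq> {}" using r by (auto simp: lessThan_empty_iff)
  have indep: "\<not> affine_dependent ?V"
    using outer_family_independent(2)[OF v] affine_dependent_imp_dependent by blast
  show "simplicial_face_of F (elliptope n)"
    unfolding F_def using convex_hull_outer_face_of_elliptope[OF sgn schur v] ne indep
    by (intro simplicial_face_of_convex_hull) auto
  show "affine_dim F = r - 1"
    unfolding F_def affine_dim_convex_hull_independent[OF ne indep]
    using card_image[OF outer_family_independent(1)[OF v]] by simp
qed

text \<open>The constant \<open>4 / 5\<close> is four times the lower bound \<open>1 / 5\<close> for \<open>1 - exp (- 1 / 4)\<close>.\<close>

theorem theorem2p11:
  shows "\<exists>c::real. c > 0 \<and> c \<ge> 0.0003 \<and>
    (\<forall>(p::real) (r::nat) (n::nat). 0 < p \<and> p < 1 \<and> 1 \<le> r \<and> 1 \<le> n \<longrightarrow>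
      measure_pmf.prob (Face p r n)
          {F. simplicial_face_of F (elliptope n) \<and> affine_dim F = r - 1}
        \<ge> 1 - 4 * exp (((real r)\<^sup>2 - c * p\<^sup>2 * (1 - p)\<^sup>2 * real n) / 4))"
proof (intro exI[of _ "4 / 5"] conjI allI impI)
  fix p :: real and r n :: nat
  assume as: "0 < p \<and> p < 1 \<and> 1 \<le> r \<and> 1 \<le> n"
  define E where "E = exp (((real r)\<^sup>2 - 4 / 5 * p\<^sup>2 * (1 - p)\<^sup>2 * real n) / 4)"
  let ?G = "{F. simplicial_face_of F (elliptope n) \<and> affine_dim F = r - 1}"
  let ?hull = "\<lambda>\<xi> :: nat \<Rightarrow> rvec. convex hull ((\<lambda>k. outer (\<xi> k)) ` {..<r})"
  have "1 - 4 * E \<le> 1 - E" by (simp add: E_def)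
  also have "\<dots> \<le> 1 - measure_pmf.prob (sign_sample p r n) {\<xi>. \<not> schur_independent n r \<xi>}"
    unfolding E_def using as prob_not_schur_independent_le[of p r n] by simp
  also have "\<dots> = measure_pmf.prob (sign_sample p r n) {\<xi>. schur_independent n r \<xi>}"
    using measure_pmf.prob_compl[of "{\<xi>. \<not> schur_independent n r \<xi>}" "sign_sample p r n"]
    by (simp add: Compl_eq_Diff_UNIV[symmetric] Collect_neg_eq[symmetric])
  also have "\<dots> \<le> measure_pmf.prob (sign_sample p r n) (?hull -` ?G)"
    using as sign_family_sample[of _ p r n] simplicial_face_of_schur_independent[of n r]
    by (intro measure_pmf.finite_measure_mono_AE) (auto simp: AE_measure_pmf_iff)
  also have "\<dots> = measure_pmf.prob (Face p r n) ?G"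
    unfolding Face_def sign_sample_def by simp
  finally show "measure_pmf.prob (Face p r n) ?G
      \<ge> 1 - 4 * exp (((real r)\<^sup>2 - 4 / 5 * p\<^sup>2 * (1 - p)\<^sup>2 * real n) / 4)"
    unfolding E_def .
qed simp_all

end
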